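(* Let $\mathbf{k}$ be an arbitrary field. For each integer $n\geq 1$ there exist a differential graded $\mathbf{k}$-module $(V,d)$ and a non-trivial polynomial deformation of order $n$ of $(V,d)$. Furthermore, a sequence $\{d_i\}_{i\geq 1}$ of elements of $C^1(V)$ can be chosen such that $V_t=(V[[t]],\ d_t=d+td_1+t^2d_2+\cdots)$ is a non-trivial deformation of $(V,d)$ with $d_i\neq 0$ for all $i\geq 1$.
   Context: Let $\mathbf{k}$ be a field. A graded $\mathbf{k}$-module is $V=\sum_{p\in\mathbf{Z}}V_p$ (direct sum), with elements of $V_p$ homogeneous of degree $p$. A $\mathbf{k}$-linear map $f:V\to V$ has degree $q$ if $f(V_p)\subset V_{p+q}$ for all $p$; the set of such maps is $\mathrm{Hom}_{\mathbf{k}}^{q}(V,V)$. A differential graded $\mathbf{k}$-module (d.g.m.) is a pair $(V,d)$ with $V$ a graded $\mathbf{k}$-module and $d:V\to V$ a $\mathbf{k}$-linear map of degree $-1$ with $d^2=0$. The $p$-cochains on $V$ are $C^p(V)=\mathrm{Hom}_{\mathbf{k}}^{-p}(V,V)$; in particular elements of $C^1(V)$ are the maps of degree $-1$ and elements of $C^0(V)$ are the maps of degree $0$. Let $t$ be an indeterminate of degree $0$ and let $V[[t]]=\{\sum_{i\geq 0} t^i v_i \mid v_i\in V\}$, a $\mathbf{k}[[t]]$-module. Any $\mathbf{k}$-linear $f:V\to V$ is extended $\mathbf{k}[[t]]$-linearly to $V[[t]]$ by $f(\sum t^i v_i)=\sum t^i f(v_i)$. Given $\{d_i\in C^1(V)\}_{i\geq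 1}$, put $d_t=d+td_1+t^2d_2+\cdots$ as a $\mathbf{k}[[t]]$-linear map on $V[[t]]$. If $d_t\circ d_t=0$, then $V_t=(V[[t]],d_t)$ is called a deformation of $(V,d)$. The trivial deformation $V_0[[t]]=(V[[t]],d)$ is the one with $d_i=0$ for all $i\geq 1$. A deformation with $d_n\neq 0$ and $d_i=0$ for all $i>n$ is a polynomial deformation of order $n$. Two deformations $(V[[t]],d_t)$ and $(V[[t]],d_t')$ of $(V,d)$ are equivalent if there is a $\mathbf{k}[[t]]$-linear automorphism $\phi_t:V[[t]]\to V[[t]]$ of the form $\phi_t=\mathrm{Id}+t\phi_1+t^2\phi_2+\cdots$ with $\phi_i\in C^0(V)$ such that $d_t\phi_t=\phi_t d_t'$. A deformation is non-trivial if it is not equivalent to the trivial deformation $V_0[[t]]$. *)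

theory Defs
  imports "HOL-Computational_Algebra.Formal_Power_Series" "HOL-Library.Product_Plus"
begin

text \<open>The module \<open>V\<close> is the whole type \<open>'v\<close>; its degree \<open>p\<close> part is \<open>V p\<close>.\<close>

locale graded_module = vector_space scale
  for scale :: "'k::field \<Rightarrow> 'v::ab_group_add \<Rightarrow> 'v" +
  fixes V :: "int \<Rightarrow> 'v set"
  assumes subspace_V: "subspace (V p)"
    and direct_sum: "\<exists>!c. (\<forall>p. c p \<in> V p) \<and> finite {p. c p \<noteq> 0} \<and> v = (\<Sum>p | c p \<noteq> 0. c p)"
begin

definition Hom :: "int \<Rightarrow> ('v \<Rightarrow> 'v) set" where
  "Hom q = {f. Vector_Spaces.linear scale scale f \<and> (\<forall>p. f ` V p \<subseteq> V (p + q))}"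

definition C :: "int \<Rightarrow> ('v \<Rightarrow> 'v) set" where
  "C p = Hom (- p)"

end

locale dg_module = graded_module scale V
  for scale :: "'k::field \<Rightarrow> 'v::ab_group_add \<Rightarrow> 'v" and V :: "int \<Rightarrow> 'v set" +
  fixes d :: "'v \<Rightarrow> 'v"
  assumes d_degree: "d \<in> Hom (- 1)"
    and d_square: "d (d v) = 0"

text \<open>\<open>V[[t]]\<close> is the type \<open>'v fps\<close>. It carries the Cauchy product action of \<open>k[[t]]\<close>.\<close>

definition fps_scale :: "('k::field \<Rightarrow> 'v::ab_group_add \<Rightarrow> 'v) \<Rightarrow> 'k fps \<Rightarrow> 'v fps \<Rightarrow> 'v fps" where
  "fps_scale scale a x = Abs_fps (\<lambda>n. \<Sum>i\<le>n. scale (fps_nth a i) (fps_nth x (n - i)))"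

context vector_space
begin

lemma module_fps_scale: "module (fps_scale scale)"
proof
  fix a b :: "'a fps" and x y :: "'b fps"
  show "fps_scale scale a (x + y) = fps_scale scale a x + fps_scale scale a y"
    by (rule fps_ext) (simp add: fps_scale_def scale_right_distrib sum.distrib)
  show "fps_scale scale (a + b) x = fps_scale scale a x + fps_scale scale b x"
    by (rule fps_ext) (simp add: fps_scale_def scale_left_distrib sum.distrib)
  show "fps_scale scale 1 x = x"
  proof (rule fps_ext)
    fix n
    have "(\<Sum>i\<le>n. scale (fps_nth 1 i) (fps_nth x (n - i))) = (\<Sum>i\<le>n. if i = 0 then fps_nth x n else 0)"
      by (rule sum.cong) auto
    then show "fps_nth (fps_scale scale 1 x) n = fps_nth x n" by (simp add: fps_scale_def)
  qed
  show "fps_scale scale a (fps_scale scale b x) = fps_scale scale (a * b) x"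
  proof (rule fps_ext)
    fix n
    have "(\<Sum>i\<le>n. \<Sum>j\<le>n - i. scale (fps_nth a i * fps_nth b j) (fps_nth x (n - i - j)))
        = (\<Sum>k\<le>n. \<Sum>i\<le>k. scale (fps_nth a i * fps_nth b (k - i)) (fps_nth x (n - k)))"
      unfolding sum.Sigma[OF finite_atMost ballI[OF finite_atMost]]
      by (rule sum.reindex_bij_witness[where j = "\<lambda>(i,j). (i + j, i)" and i = "\<lambda>(k,i). (i, k - i)"]) auto
    then show "fps_nth (fps_scale scale a (fps_scale scale b x)) n = fps_nth (fps_scale scale (a * b) x) n"
      by (simp add: fps_scale_def scale_sum_right scale_sum_left fps_mult_nth atLeast0AtMost)
  qed
qed

end

text \<open>For linear \<open>f i\<close>, \<open>series_map f\<close> is \<open>f 0 + t f 1 + t^2 f 2 + \<dots>\<close> with every \<open>f i\<close> extended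
  \<open>k[[t]]\<close>-linearly to \<open>V[[t]]\<close>, that is, coefficientwise: the coefficient of \<open>t^n\<close> in
  \<open>\<Sum>i. t^i (\<Sum>j. t^j f i (x j))\<close> collects the pairs with \<open>i + j = n\<close>.\<close>

definition series_map :: "(nat \<Rightarrow> 'v \<Rightarrow> 'v) \<Rightarrow> 'v fps \<Rightarrow> 'v::ab_group_add fps" where
  "series_map f x = Abs_fps (\<lambda>n. \<Sum>i\<le>n. f i (fps_nth x (n - i)))"

context dg_module
begin

text \<open>A sequence \<open>(d\<^sub>i)\<close> with \<open>i \<ge> 1\<close> is a function on \<open>nat\<close> whose value at \<open>0\<close> is ignored:
  the update at \<open>0\<close> puts the constant term in its place.\<close>

definition deformation_map :: "(nat \<Rightarrow> 'v \<Rightarrow> 'v) \<Rightarrow> 'v fps \<Rightarrow> 'v fps" where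
  "deformation_map ds = series_map (ds(0 := d))"

definition deformation :: "(nat \<Rightarrow> 'v \<Rightarrow> 'v) \<Rightarrow> bool" where
  "deformation ds \<longleftrightarrow> (\<forall>i\<ge>1. ds i \<in> C 1) \<and> deformation_map ds \<circ> deformation_map ds = (\<lambda>x. 0)"

definition polynomial_deformation :: "nat \<Rightarrow> (nat \<Rightarrow> 'v \<Rightarrow> 'v) \<Rightarrow> bool" where
  "polynomial_deformation n ds \<longleftrightarrow>
     deformation ds \<and> ds n \<noteq> (\<lambda>v. 0) \<and> (\<forall>i>n. ds i = (\<lambda>v. 0))"

definition equivalent :: "(nat \<Rightarrow> 'v \<Rightarrow> 'v) \<Rightarrow> (nat \<Rightarrow> 'v \<Rightarrow> 'v) \<Rightarrow> bool" where
  "equivalent ds ds' \<longleftrightarrow>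
     (\<exists>\<Phi> \<phi>. module_hom (fps_scale scale) (fps_scale scale) \<Phi> \<and> bij \<Phi> \<and>
        (\<forall>i\<ge>1. \<phi> i \<in> C 0) \<and> \<Phi> = series_map (\<phi>(0 := id)) \<and>
        deformation_map ds \<circ> \<Phi> = \<Phi> \<circ> deformation_map ds')"

definition trivial_deformation :: "nat \<Rightarrow> 'v \<Rightarrow> 'v" where
  "trivial_deformation = (\<lambda>i v. 0)"

definition nontrivial :: "(nat \<Rightarrow> 'v \<Rightarrow> 'v) \<Rightarrow> bool" where
  "nontrivial ds \<longleftrightarrow> \<not> equivalent ds trivial_deformation"

end

end

theory Submission imports Defs begin

text \<open>Let \<open>V\<close> have basis \<open>x\<close> in degree 1 and \<open>y\<close> in degree 0, with zero differential, and
  let \<open>e\<close> be the map of degree \<open>- 1\<close> sending \<open>x\<close> to \<open>y\<close> and \<open>y\<close> to 0. As \<open>e \<circ> e = 0\<close>, every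
  series \<open>\<Sum>i\<ge>1. t^i c\<^sub>i e\<close> with scalars \<open>c\<^sub>i\<close> squares to zero and so is a deformation. The
  single term \<open>t^n e\<close> gives order \<open>n\<close>, and taking all \<open>c\<^sub>i\<close> equal to 1 gives a deformation
  with no vanishing coefficient.

  Non-triviality costs nothing because \<open>d = 0\<close>: the trivial deformation is then the zero map,
  and a map conjugate to zero is zero. So a deformation of a module with zero differential is
  trivial only if all its coefficients vanish (\<open>nontrivial_if_zero_differential\<close>).\<close>

context dg_module
begin

lemma module_hom_if_in_C: "f \<in> C p \<Longrightarrow> module_hom scale scale f"
  by (simp add: C_def Hom_def module_hom_iff_linear)

text \<open>Each coefficient of the square of the perturbed differential is a sum of composites of two
  coefficient maps. Asking that each composite vanish is much stronger than asking that the sums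
  do, but it suits families of multiples of one square-zero map.\<close>

lemma deformation_if_composites_vanish:
  assumes d: "d = (\<lambda>v. 0)"
    and C: "\<And>i. i \<ge> 1 \<Longrightarrow> ds i \<in> C 1"
    and comp: "\<And>i j v. i \<ge> 1 \<Longrightarrow> j \<ge> 1 \<Longrightarrow> ds i (ds j v) = 0"
  shows "deformation ds"
proof -
  let ?f = "ds(0 := d)"
  have lin: "module_hom scale scale (?f i)" for i
    using C[of i] d_degree module_hom_if_in_C[of "?f i" 1]
    by (cases "i = 0") (simp_all add: C_def)
  have zero: "?f i 0 = 0" for i
    by (rule module_hom.zero[OF lin])
  have ff: "?f i (?f j v) = 0" for i j v
    using comp[of i j v] zero[of i] d by (cases "i = 0"; cases "j = 0") auto
  have "series_map ?f (series_map ?f x) = 0" for x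
  proof (rule fps_ext)
    fix n
    have "?f i (\<Sum>j\<le>m. ?f j (g j)) = 0" for i m and g :: "nat \<Rightarrow> 'v"
      by (subst module_hom.sum[OF lin]) (simp only: ff sum.neutral_const)
    then show "fps_nth (series_map ?f (series_map ?f x)) n = fps_nth 0 n"
      by (simp only: series_map_def fps_nth_Abs_fps sum.neutral_const fps_zero_nth)
  qed
  then show ?thesis
    using C by (simp add: deformation_def deformation_map_def fun_eq_iff)
qed

text \<open>The trivial deformation is the zero map, so an equivalence \<open>\<Phi>\<close> to it gives
  \<open>d\<^sub>t \<circ> \<Phi> = 0\<close>. Since \<open>\<Phi>\<close> is onto, \<open>d\<^sub>t = 0\<close>, and the values of \<open>d\<^sub>t\<close> on
  constant series recover every coefficient.\<close>

lemma nontrivial_if_zero_differential: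
  assumes d: "d = (\<lambda>v. 0)" and def: "deformation ds"
    and i: "i \<ge> 1" "ds i \<noteq> (\<lambda>v. 0)"
  shows "nontrivial ds"
  unfolding nontrivial_def
proof
  assume "equivalent ds trivial_deformation"
  then obtain \<Phi> where hom: "module_hom (fps_scale scale) (fps_scale scale) \<Phi>" and bij: "bij \<Phi>"
    and eq: "deformation_map ds \<circ> \<Phi> = \<Phi> \<circ> deformation_map trivial_deformation"
    unfolding equivalent_def by blast
  have triv: "deformation_map trivial_deformation x = 0" for x
    unfolding deformation_map_def
    by (rule fps_ext) (simp add: series_map_def trivial_deformation_def d)
  have zero: "deformation_map ds y = 0" for y
  proof -
    obtain x where "y = \<Phi> x" using bij by (meson bij_pointE)
    then show ?thesis
      using fun_cong[OF eq, of x] triv module_hom.zero[OF hom] by simp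
  qed
  from i obtain v where v: "ds i v \<noteq> 0" by auto
  have f0: "(ds(0 := d)) j 0 = 0" for j
    using def module_hom.zero[OF module_hom_if_in_C, of "ds j" 1]
    unfolding deformation_def by (cases "j = 0") (simp_all add: d)
  have "fps_nth (deformation_map ds (fps_const v)) i
      = (\<Sum>j\<le>i. (ds(0 := d)) j (if i - j = 0 then v else 0))"
    by (simp add: deformation_map_def series_map_def)
  also have "\<dots> = (\<Sum>j\<le>i. if j = i then ds i v else 0)"
    using i by (intro sum.cong refl) (use f0 in auto)
  finally have "fps_nth (deformation_map ds (fps_const v)) i = ds i v"
    by simp
  then show False
    using v zero by simp
qed

end

definition plane_scale :: "'k::field \<Rightarrow> 'k \<times> 'k \<Rightarrow> 'k \<times> 'k" where
  "plane_scale c v = (c * fst v, c * snd v)"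

definition plane_grading :: "int \<Rightarrow> ('k::field \<times> 'k) set" where
  "plane_grading p = (if p = 1 then UNIV \<times> {0} else if p = 0 then {0} \<times> UNIV else {0})"

definition plane_shift :: "'k::field \<times> 'k \<Rightarrow> 'k \<times> 'k" where
  "plane_shift v = (0, fst v)"

lemma vector_space_plane: "vector_space plane_scale"
  by unfold_locales (auto simp: plane_scale_def algebra_simps)

lemma sum_in_plane_grading:
  assumes "\<forall>p. c p \<in> plane_grading p"
  shows "finite {p. c p \<noteq> 0}" "(\<Sum>p | c p \<noteq> 0. c p) = c 0 + c 1"
proof -
  have sub: "{p. c p \<noteq> 0} \<subseteq> {0, 1}"
  proof
    fix p assume "p \<in> {p. c p \<noteq> 0}"
    with assms[rule_format, of p] show "p \<in> {0, 1}"
      by (auto simp: plane_grading_def split: if_splits)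
  qed
  then show "finite {p. c p \<noteq> 0}"
    by (rule finite_subset) simp
  have "(\<Sum>p | c p \<noteq> 0. c p) = (\<Sum>p\<in>{0, 1}. c p)"
    by (rule sum.mono_neutral_left) (use sub in auto)
  then show "(\<Sum>p | c p \<noteq> 0. c p) = c 0 + c 1"
    by simp
qed

lemma dg_module_plane: "dg_module plane_scale plane_grading (\<lambda>v :: 'k::field \<times> 'k. 0)"
proof -
  interpret vector_space "plane_scale :: 'k \<Rightarrow> _"
    by (rule vector_space_plane)
  interpret graded_module "plane_scale :: 'k \<Rightarrow> _" plane_grading
  proof
    show "subspace (plane_grading p :: ('k \<times> 'k) set)" for p
      by (auto simp: subspace_def plane_grading_def plane_scale_def zero_prod_def)
    fix v :: "'k \<times> 'k"
    let ?c = "\<lambda>p. if p = 1 then (fst v, 0) else if p = 0 then (0, snd v) else 0"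
    let ?P = "\<lambda>c. (\<forall>p. c p \<in> plane_grading p) \<and> finite {p. c p \<noteq> 0} \<and> v = (\<Sum>p | c p \<noteq> 0. c p)"
    have c: "\<forall>p. ?c p \<in> plane_grading p"
      by (simp add: plane_grading_def)
    show "\<exists>!c. ?P c"
    proof (rule ex1I)
      show "?P ?c"
        using c sum_in_plane_grading[OF c] by simp
    next
      fix c assume P: "?P c"
      then have mem: "c p \<in> plane_grading p" for p by blast
      have v: "v = c 0 + c 1"
        using P sum_in_plane_grading(2)[of c] by simp
      have c0: "fst (c 0) = 0" and c1: "snd (c 1) = 0"
        using mem[of 0] mem[of 1] by (auto simp: plane_grading_def)
      show "c = ?c"
      proof
        fix p
        show "c p = ?c p"
          using mem[of p] v c0 c1 by (auto simp: plane_grading_def prod_eq_iff)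
      qed
    qed
  qed
  show ?thesis
  proof
    show "(\<lambda>v. 0) \<in> Hom (- 1)"
      using subspace_0[OF subspace_V] by (auto simp: Hom_def module_hom_iff_linear[symmetric] module_hom_iff module_axioms)
  qed simp
qed

interpretation plane: dg_module "plane_scale :: 'k::field \<Rightarrow> _" plane_grading "\<lambda>v. 0"
  by (rule dg_module_plane)

lemma plane_shift_in_C: "plane_shift \<in> plane.C 1"
proof -
  have "Vector_Spaces.linear plane_scale plane_scale plane_shift"
    by unfold_locales (auto simp: plane_shift_def plane_scale_def)
  then show ?thesis
    by (auto simp: plane.C_def plane.Hom_def plane_grading_def plane_shift_def zero_prod_def)
qed

lemma plane_shift_nonzero: "plane_shift \<noteq> (\<lambda>v :: 'k::field \<times> 'k. 0)"
  by (auto simp: plane_shift_def zero_prod_def fun_eq_iff intro!: exI[of _ 1])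

text \<open>A set \<open>S\<close> of exponents selects the deformation \<open>\<Sum>i\<in>S. t^i e\<close>, with \<open>e\<close> the shift; this
  covers the polynomial and the infinite case at once.\<close>

lemma plane_deformation:
  fixes S :: "nat set"
  defines "ds \<equiv> \<lambda>i. if i \<in> S then plane_shift else (\<lambda>v :: 'k::field \<times> 'k. 0)"
  assumes "i \<in> S" "i \<ge> 1"
  shows "plane.deformation ds" "plane.nontrivial ds"
proof -
  show def: "plane.deformation ds"
  proof (rule plane.deformation_if_composites_vanish)
    show "ds j \<in> plane.C 1" for j
      by (simp add: ds_def plane_shift_in_C plane.d_degree[folded plane.C_def])
    show "ds j (ds k v) = 0" for j k v
      by (simp add: ds_def plane_shift_def zero_prod_def)
  qed simp
  show "plane.nontrivial ds"
    by (rule plane.nontrivial_if_zero_differential[OF refl def \<open>i \<ge> 1\<close>])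
      (simp add: ds_def \<open>i \<in> S\<close> plane_shift_nonzero)
qed

theorem theorem3p1:
  fixes n :: nat
  assumes "n \<ge> 1"
  shows "\<exists>(scale :: 'k::field \<Rightarrow> 'k \<times> 'k \<Rightarrow> 'k \<times> 'k) V d.
    dg_module scale V d \<and>
    (\<exists>ds. dg_module.polynomial_deformation scale V d n ds \<and> dg_module.nontrivial scale V d ds) \<and>
    (\<exists>ds. dg_module.deformation scale V d ds \<and> dg_module.nontrivial scale V d ds \<and>
          (\<forall>i\<ge>1. ds i \<noteq> (\<lambda>v. 0)))"
proof (intro exI conjI)
  let ?ds = "\<lambda>S i. if i \<in> S then plane_shift else (\<lambda>v :: 'k \<times> 'k. 0)"
  show "dg_module plane_scale plane_grading (\<lambda>v :: 'k \<times> 'k. 0)"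
    by (rule dg_module_plane)
  show "plane.polynomial_deformation n (?ds {n})"
    using plane_deformation(1)[of n "{n}"] assms
    by (simp add: plane.polynomial_deformation_def plane_shift_nonzero)
  show "plane.nontrivial (?ds {n})"
    using assms by (intro plane_deformation(2)[of n]) auto
  show "plane.deformation (?ds UNIV)" "plane.nontrivial (?ds UNIV)"
    by (rule plane_deformation[of 1]; simp)+
  show "\<forall>i\<ge>1. ?ds UNIV i \<noteq> (\<lambda>v. 0)"
    by (simp add: plane_shift_nonzero)
qed

end
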